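(* Let $r\ge3$ and let $\mathcal{H}$ be a connected $r$-uniform hypergraph on $n$ vertices whose longest Berge path has length $k$ with $1<k\le r$. Then there exists a nonempty set $S\subseteq V(\mathcal{H})$ such that $p_{\mathcal{H}}(e)=k$ for every $e\in N(S)$ and $S$ satisfies one of the following: (i) $k=r$, $|S|=r$ and $|N(S)|\le r$; (ii) $k=r$, $|S|\ge r+1$ and $|N(S)|\le r+1$; (iii) $1<k<r$, $|S|\ge r+1$ and $|N(S)|\le k$; (iv) $|S|=r-1$ and $|N(S)|=1$. Furthermore, $\mathcal{H}$ has a good set, i.e. $\mathcal{S}_r(\mathcal{H})\ne\emptyset$.
   Context: Hypergraphs are simple. A Berge path of length $k$ is an alternating sequence $v_0e_1v_1\cdots v_{k-1}e_kv_k$ of distinct vertices and distinct edges with $v_{i-1},v_i\in e_i$. Connected means every two distinct vertices are joined by a Berge path. $p_{\mathcal{H}}(e)$ is the maximum length of a Berge path having $e$ as a defining edge. For $S\subseteq V(\mathcal{H})$, $N(S)=\{e\in E(\mathcal{H}):e\cap S\neq\emptyset\}$. For real $x\ge1$, $f_r(x)=\frac1r$ if $x=1$, $\frac{x}{r+1}$ if $1<x\le r-1$, $\frac1r\binom{x}{r-1}$ if $x\ge r$. If the longest Berge path of $\mathcal{H}$ has length $k$, a good set is a nonempty $S\subseteq V(\mathcal{H})$ with $p_{\mathcal{H}}(e)=k$ for all $e\in N(S)$ and $|N(S)|\le f_r(k)|S|$; $\mathcal{S}_r(\mathcal{H})$ is the family of all good sets. *)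

theory Defs imports Complex_Main begin

text \<open>
  A simple hypergraph is given by its finite vertex set \<open>V\<close> and its set of edges \<open>E\<close>; as \<open>E\<close> is a
  set of vertex sets, there are no repeated edges.
\<close>

definition hypergraph :: "'a set \<Rightarrow> 'a set set \<Rightarrow> bool" where
  "hypergraph V E \<longleftrightarrow> finite V \<and> (\<forall>e\<in>E. e \<subseteq> V)"

definition uniform :: "nat \<Rightarrow> 'a set set \<Rightarrow> bool" where
  "uniform r E \<longleftrightarrow> (\<forall>e\<in>E. card e = r)"

text \<open>
  The path $v_0 e_1 v_1 \ldots e_k v_k$ is represented by the two lists \<open>[v\<^sub>0, \<dots>, v\<^sub>k]\<close> and
  \<open>[e\<^sub>1, \<dots>, e\<^sub>k]\<close>, so \<open>es ! i\<close> is the edge $e_{i+1}$ and the length of the path is \<open>length es\<close>.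
  A single vertex is a path of length 0.
\<close>

definition berge_path :: "'a set \<Rightarrow> 'a set set \<Rightarrow> 'a list \<Rightarrow> 'a set list \<Rightarrow> bool" where
  "berge_path V E vs es \<longleftrightarrow>
     length vs = Suc (length es) \<and> distinct vs \<and> distinct es \<and> set vs \<subseteq> V \<and> set es \<subseteq> E \<and>
     (\<forall>i < length es. vs ! i \<in> es ! i \<and> vs ! Suc i \<in> es ! i)"

definition hyp_connected :: "'a set \<Rightarrow> 'a set set \<Rightarrow> bool" where
  "hyp_connected V E \<longleftrightarrow>
     (\<forall>u\<in>V. \<forall>v\<in>V. u \<noteq> v \<longrightarrow> (\<exists>vs es. berge_path V E vs es \<and> hd vs = u \<and> last vs = v))"

definition longest_path_length :: "'a set \<Rightarrow> 'a set set \<Rightarrow> nat \<Rightarrow> bool" where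
  "longest_path_length V E k \<longleftrightarrow>
     (\<exists>vs es. berge_path V E vs es \<and> length es = k) \<and>
     (\<forall>vs es. berge_path V E vs es \<longrightarrow> length es \<le> k)"

text \<open>
  The \<open>Max\<close> below is over a finite set when \<open>V\<close> is finite, and over a nonempty one when \<open>e\<close> is
  an edge with at least two vertices.
\<close>

definition path_number :: "'a set \<Rightarrow> 'a set set \<Rightarrow> 'a set \<Rightarrow> nat" where
  "path_number V E e = Max {length es | vs es. berge_path V E vs es \<and> e \<in> set es}"

definition incident_edges :: "'a set set \<Rightarrow> 'a set \<Rightarrow> 'a set set" where
  "incident_edges E S = {e \<in> E. e \<inter> S \<noteq> {}}"

text \<open>
  The function $f_r$ is specified only for $x = 1$, $1 < x \le r - 1$ and $x \ge r$; this covers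
  all integers $x \ge 1$, and the remaining reals get the value \<open>undefined\<close>.
\<close>

definition f_bound :: "nat \<Rightarrow> real \<Rightarrow> real" where
  "f_bound r x =
     (if x = 1 then 1 / real r
      else if 1 < x \<and> x \<le> real r - 1 then x / (real r + 1)
      else if x \<ge> real r then 1 / real r * (x gchoose (r - 1))
      else undefined)"

text \<open>The number \<open>k\<close> in the following definition is unique if it exists.\<close>

definition good_sets :: "nat \<Rightarrow> 'a set \<Rightarrow> 'a set set \<Rightarrow> 'a set set" where
  "good_sets r V E =
     {S. S \<subseteq> V \<and> S \<noteq> {} \<and>
         (\<exists>k. longest_path_length V E k \<and>
              (\<forall>e \<in> incident_edges E S. path_number V E e = k) \<and>
              real (card (incident_edges E S)) \<le> f_bound r (real k) * real (card S))}"

end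

theory Submission imports Defs begin

text \<open>
  If there is a cycle of length \<open>k + 1\<close>, or one of length \<open>k = r\<close>, then the longest paths
  obtained by opening it are so rigid that there are at most \<open>r + 1\<close> edges, and \<open>S = V\<close> works. If
  there is a cycle of length \<open>k < r\<close>, take for \<open>S\<close> the union of its edges. Otherwise fix a longest
  path and let \<open>S\<close> be the set of all ends of paths with the same edges. By maximality and the lack of
  cycles, only these \<open>k\<close> edges meet \<open>S\<close>, and rotating the path produces \<open>r\<close> ends, and
  \<open>r + 1\<close> of them if \<open>k < r\<close>.
\<close>

text \<open>Why cycles are the obstacle: let \<open>g\<close> be an edge off a longest path that
  contains its first vertex. By maximality \<open>g\<close> stays inside the path's vertex set.
  Either \<open>g\<close> contains the last vertex and closes a cycle of length k + 1, or it fits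
  into the other k \<le> r vertices; then it fills them, k = r, and it closes a cycle of length k.
  The number of ends comes from the first edge: each of its r vertices is charged with one end. The
  difficulty is distinctness, since different rotations may offer the same vertex. For k < r the
  last edge supplies one more end, because it avoids the first vertex and so cannot fit into the
  path. The sizes r and r + 1 are dictated by f_r: since f_r(r) = 1, a good set for k = r needs
  |N(S)| \<le> |S|, and f_r(k) = k / (r + 1) for 1 < k < r admits k edges once |S| \<ge> r +
  1.\<close>

section \<open>Berge paths: cutting, gluing and rotating\<close>

lemma berge_path_singleton [simp]: "berge_path V E [v] [] \<longleftrightarrow> v \<in> V"
  by (auto simp: berge_path_def)

lemma berge_path_nonempty: "berge_path V E vs es \<Longrightarrow> vs \<noteq> []"
  by (auto simp: berge_path_def)

text \<open>Cutting a path at an edge and gluing two paths along an edge are the two directions of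
  one equivalence. The rotations of paths and cycles cut with one direction and glue the rearranged
  pieces with the other.\<close>

lemma berge_path_append_iff:
  assumes "length p = Suc (length ea)" "length q = Suc (length eb)"
  shows "berge_path V E (p @ q) (ea @ e # eb) \<longleftrightarrow>
    berge_path V E p ea \<and> berge_path V E q eb \<and> set p \<inter> set q = {} \<and> set ea \<inter> set eb = {} \<and>
    e \<in> E \<and> e \<notin> set ea \<and> e \<notin> set eb \<and> last p \<in> e \<and> hd q \<in> e"
proof -
  let ?inc = "\<lambda>vs es. \<forall>i<length es. vs ! i \<in> es ! i \<and> vs ! Suc i \<in> (es ! i :: 'a set)"
  have last: "last p = p ! length ea" and hd: "hd q = q ! 0"
    using assms by (auto simp: last_conv_nth hd_conv_nth simp flip: length_greater_0_conv)
  have "?inc (p @ q) (ea @ e # eb) \<longleftrightarrow> ?inc p ea \<and> last p \<in> e \<and> hd q \<in> e \<and> ?inc q eb" (is "?L \<longleftrightarrow> ?R")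
  proof
    assume L: ?L
    have "p ! i \<in> ea ! i \<and> p ! Suc i \<in> ea ! i" if "i < length ea" for i
      using L[rule_format, of i] that assms by (auto simp: nth_append)
    moreover have "last p \<in> e \<and> hd q \<in> e"
      using L[rule_format, of "length ea"] assms by (auto simp: nth_append last hd)
    moreover have "q ! i \<in> eb ! i \<and> q ! Suc i \<in> eb ! i" if "i < length eb" for i
      using L[rule_format, of "Suc (length ea + i)"] that assms by (auto simp: nth_append)
    ultimately show ?R by auto
  next
    assume R: ?R
    show ?L
    proof (intro allI impI)
      fix i assume i: "i < length (ea @ e # eb)"
      consider "i < length ea" | "i = length ea" | j where "i = Suc (length ea + j)" "j < length eb"
      proof (cases "i \<le> length ea")
        case False
        then obtain j where "i = Suc (length ea + j)"
          by (metis add_Suc less_imp_Suc_add not_le)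
        then show ?thesis using i that(3) by auto
      qed (use that in linarith)
      then show "(p @ q) ! i \<in> (ea @ e # eb) ! i \<and> (p @ q) ! Suc i \<in> (ea @ e # eb) ! i"
        using R assms by cases (auto simp: nth_append last hd)
    qed
  qed
  then show ?thesis unfolding berge_path_def using assms by auto
qed

lemma berge_path_Cons:
  assumes "berge_path V E q eb" "v \<in> V" "v \<notin> set q" "e \<in> E" "e \<notin> set eb" "v \<in> e" "hd q \<in> e"
  shows "berge_path V E (v # q) (e # eb)"
  using berge_path_append_iff[of "[v]" "[]" q eb V E e] assms by (auto simp: berge_path_def)

lemma berge_path_Cons_iff:
  assumes "length q = Suc (length eb)"
  shows "berge_path V E (v # q) (e # eb) \<longleftrightarrow>
    berge_path V E q eb \<and> v \<in> V \<and> v \<notin> set q \<and> e \<in> E \<and> e \<notin> set eb \<and> v \<in> e \<and> hd q \<in> e"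
  using berge_path_append_iff[of "[v]" "[]" q eb V E e] assms by auto

lemma berge_path_rev:
  assumes "berge_path V E vs es"
  shows "berge_path V E (rev vs) (rev es)"
proof -
  have "rev vs ! i \<in> rev es ! i \<and> rev vs ! Suc i \<in> rev es ! i" if "i < length es" for i
  proof -
    have "rev es ! i = es ! (length es - Suc i)" "rev vs ! i = vs ! Suc (length es - Suc i)"
      "rev vs ! Suc i = vs ! (length es - Suc i)"
      using assms that by (auto simp: berge_path_def rev_nth Suc_diff_Suc)
    then show ?thesis using assms that by (auto simp: berge_path_def)
  qed
  then show ?thesis using assms by (auto simp: berge_path_def)
qed

lemma berge_path_split:
  assumes "berge_path V E vs es" "i < length es"
  obtains p q ea eb where "vs = p @ q" "es = ea @ es ! i # eb" "length ea = i"
    "length p = Suc (length ea)" "length q = Suc (length eb)"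
proof
  show "vs = take (Suc i) vs @ drop (Suc i) vs" by simp
  show "es = take i es @ es ! i # drop (Suc i) es" using assms by (simp add: id_take_nth_drop)
qed (use assms in \<open>auto simp: berge_path_def\<close>)

text \<open>Reversing the segment before \<open>es ! i\<close> makes the old first vertex the one
  that leaves through \<open>es ! i\<close>. The new end is \<open>vs ! i\<close>, and the edges are
  merely reordered.\<close>

lemma berge_path_rotate:
  assumes P: "berge_path V E vs es" and i: "i < length es" and "hd vs \<in> es ! i"
  obtains vs' es' where "berge_path V E vs' es'" "set es' = set es" "hd vs' = vs ! i"
proof -
  obtain p q ea eb where s: "vs = p @ q" "es = ea @ es ! i # eb" "length ea = i"
    "length p = Suc (length ea)" "length q = Suc (length eb)"
    using berge_path_split[OF P i] .
  have "p \<noteq> []" using s(4) by auto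
  have "berge_path V E (p @ q) (ea @ es ! i # eb)" using P s(1,2) by simp
  then have "berge_path V E (rev p @ q) (rev ea @ es ! i # eb)"
    using s(4,5) assms(3) \<open>p \<noteq> []\<close>
    by (subst (asm) berge_path_append_iff) (auto simp: berge_path_append_iff last_rev s(1) intro: berge_path_rev)
  moreover have "set (rev ea @ es ! i # eb) = set es" by (subst (2) s(2)) auto
  moreover have "hd (rev p @ q) = vs ! i"
    using s(1,3,4) \<open>p \<noteq> []\<close> by (simp add: hd_rev last_conv_nth nth_append)
  ultimately show thesis using that by blast
qed

text \<open>
  Posa rotation: the edge by which the path can be entered from outside changes from \<open>es ! 0\<close> to \<open>es ! i\<close>.
\<close>

lemma berge_path_reroute:
  assumes P: "berge_path V E vs es" and i: "i < length es" and "vs ! Suc i \<in> es ! 0"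
  obtains us fs where "berge_path V E us fs" "set us = set (tl vs)" "length fs = length es - 1"
    "es ! i \<notin> set fs" "set es = insert (es ! i) (set fs)" "hd us \<in> es ! i" "last us = last vs"
    "drop i us = drop (Suc i) vs" "drop i fs = drop (Suc i) es"
proof (cases i)
  case 0
  obtain v q where vq: "vs = v # q" using berge_path_nonempty[OF P] by (cases vs) auto
  obtain e eb where e: "es = e # eb" using i by (cases es) auto
  have l: "length q = Suc (length eb)" using P vq e by (auto simp: berge_path_def)
  have "berge_path V E q eb" "e \<notin> set eb" "hd q \<in> e"
    using P berge_path_Cons_iff[OF l] by (auto simp: vq e)
  moreover have "q \<noteq> []" using l by auto
  ultimately show thesis using that[of q eb] l by (auto simp: vq e 0)
next
  case (Suc j)
  obtain p q ea eb where s: "vs = p @ q" "es = ea @ es ! i # eb" "length ea = i"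
    "length p = Suc (length ea)" "length q = Suc (length eb)"
    using berge_path_split[OF P i] .
  obtain v p' where p: "p = v # p'" using s(4) by (cases p) auto
  obtain e ea' where ea: "ea = e # ea'" using s(3) Suc by (cases ea) auto
  have l: "length p' = Suc (length ea')" using s(4) p ea by auto
  have ne: "p' \<noteq> []" "q \<noteq> []" using l s(5) by auto
  have li: "i = Suc (length ea')" using s(3) ea by simp
  have d: "drop (Suc i) es = eb" by (subst s(2)) (simp add: s(3))
  have e0: "es ! 0 = e" by (subst s(2)) (simp add: ea)
  have hq: "hd q \<in> e" using assms(3) e0 s(1,3,4) ne by (simp add: nth_append hd_conv_nth)
  have "berge_path V E (p @ q) (ea @ es ! i # eb)" using P s(1,2) by simp
  then have *: "berge_path V E p ea" "berge_path V E q eb" "set p \<inter> set q = {}" "set ea \<inter> set eb = {}"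
    "es ! i \<notin> set ea" "es ! i \<notin> set eb" "last p \<in> es ! i"
    using berge_path_append_iff[OF s(4,5)] by blast+
  have "berge_path V E (v # p') (e # ea')" using *(1) p ea by simp
  then have **: "berge_path V E p' ea'" "e \<in> E" "e \<notin> set ea'" "hd p' \<in> e"
    using berge_path_Cons_iff[OF l] by blast+
  \<comment> \<open>With \<open>v = hd vs\<close> dropped, both the old second vertex and
    \<open>vs ! Suc i\<close> lie in \<open>e\<close>, which therefore joins the reversed segment to
    the untouched tail. This releases \<open>es ! i\<close>, which contains the new first vertex
    \<open>vs ! i\<close>.\<close>
  show thesis
  proof (rule that[of "rev p' @ q" "rev ea' @ e # eb"])
    show "berge_path V E (rev p' @ q) (rev ea' @ e # eb)"
      using * ** hq l s(5) p ea ne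
      by (subst berge_path_append_iff) (auto simp: last_rev intro: berge_path_rev)
    show "set es = insert (es ! i) (set (rev ea' @ e # eb))" by (subst s(2)) (auto simp: ea)
    show "length (rev ea' @ e # eb) = length es - 1" by (subst s(2)) (simp add: ea)
    show "hd (rev p' @ q) \<in> es ! i" using *(7) ne p by (simp add: hd_rev)
    show "drop i (rev p' @ q) = drop (Suc i) vs" using s p l by (simp add: ea)
    show "drop i (rev ea' @ e # eb) = drop (Suc i) es" using d by (simp add: li)
  qed (use s p * ea ne in auto)
qed

section \<open>Berge cycles\<close>

text \<open>A cycle is stored as a path opened at the edge \<open>f\<close>. It has as many edges as
  vertices, so its length is \<open>length vs\<close>, one more than that of the path.\<close>

definition berge_cycle :: "'a set \<Rightarrow> 'a set set \<Rightarrow> 'a list \<Rightarrow> 'a set list \<Rightarrow> 'a set \<Rightarrow> bool" where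
  "berge_cycle V E vs es f \<longleftrightarrow>
     berge_path V E vs es \<and> f \<in> E \<and> f \<notin> set es \<and> hd vs \<in> f \<and> last vs \<in> f"

lemma berge_cycle_rev:
  "berge_cycle V E vs es f \<Longrightarrow> berge_cycle V E (rev vs) (rev es) f"
  by (auto simp: berge_cycle_def hd_rev last_rev intro: berge_path_rev)

text \<open>Swapping the two pieces on either side of \<open>es ! i\<close> joins them through the
  old closing edge \<open>f\<close>, so that \<open>es ! i\<close> takes over the role of
  \<open>f\<close>.\<close>

lemma berge_cycle_rotate:
  assumes C: "berge_cycle V E vs es f" and i: "i < length es"
  obtains vs' es' where "berge_cycle V E vs' es' (es ! i)" "set vs' = set vs"
    "insert (es ! i) (set es') = insert f (set es)" "last vs' = vs ! i" "length vs' = length vs"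
proof -
  have P: "berge_path V E vs es" using C by (simp add: berge_cycle_def)
  obtain p q ea eb where s: "vs = p @ q" "es = ea @ es ! i # eb" "length ea = i"
    "length p = Suc (length ea)" "length q = Suc (length eb)"
    using berge_path_split[OF P i] .
  have ne: "p \<noteq> []" "q \<noteq> []" using s(4,5) by auto
  have "berge_path V E (p @ q) (ea @ es ! i # eb)" using P s(1,2) by simp
  then have *: "berge_path V E p ea" "berge_path V E q eb" "set p \<inter> set q = {}" "set ea \<inter> set eb = {}"
    "es ! i \<in> E" "es ! i \<notin> set ea" "es ! i \<notin> set eb" "last p \<in> es ! i" "hd q \<in> es ! i"
    using berge_path_append_iff[OF s(4,5)] by blast+
  have ses: "set es = insert (es ! i) (set ea \<union> set eb)" by (subst s(2)) auto
  have f: "f \<in> E" "f \<notin> set es" "hd p \<in> f" "last q \<in> f"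
    using C ne s(1) by (auto simp: berge_cycle_def)
  show thesis
  proof (rule that[of "q @ p" "eb @ f # ea"])
    have "berge_path V E (q @ p) (eb @ f # ea)"
      using * f s(4,5) ses by (subst berge_path_append_iff) auto
    then show "berge_cycle V E (q @ p) (eb @ f # ea) (es ! i)"
      using * f ne ses by (auto simp: berge_cycle_def)
    show "last (q @ p) = vs ! i" using ne s(1,3,4) by (simp add: last_conv_nth nth_append)
  qed (use s(1) ses in auto)
qed

lemma berge_cycle_closing_edge:
  assumes C: "berge_cycle V E vs es f" and "e \<in> insert f (set es)"
  obtains vs' es' where "berge_cycle V E vs' es' e" "set vs' = set vs"
    "insert e (set es') = insert f (set es)" "length vs' = length vs"
proof (cases "e = f")
  case True
  then show thesis using that C by blast
next
  case False
  then obtain i where "i < length es" "es ! i = e" using assms(2) by (auto simp: in_set_conv_nth)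
  then show thesis using berge_cycle_rotate[OF C, of i] that by metis
qed

lemma berge_cycle_start:
  assumes C: "berge_cycle V E vs es f" and "v \<in> set vs"
  obtains vs' es' f' where "berge_cycle V E vs' es' f'" "set vs' = set vs"
    "insert f' (set es') = insert f (set es)" "hd vs' = v" "length vs' = length vs"
proof -
  obtain i where i: "i < length vs" "vs ! i = v" using assms(2) by (auto simp: in_set_conv_nth)
  have l: "length vs = Suc (length es)" using C by (auto simp: berge_cycle_def berge_path_def)
  show thesis
  proof (cases "i < length es")
    case True
    then obtain vs' es' where "berge_cycle V E vs' es' (es ! i)" "set vs' = set vs"
      "insert (es ! i) (set es') = insert f (set es)" "last vs' = v" "length vs' = length vs"
      using berge_cycle_rotate[OF C True] i by metis
    then show thesis using that[of "rev vs'" "rev es'" "es ! i"] by (auto simp: hd_rev dest: berge_cycle_rev)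
  next
    case False
    then have "last vs = v" using i l by (metis last_conv_nth diff_Suc_1 less_antisym list.size(3) not_less_zero)
    then show thesis using that[of "rev vs" "rev es" f] C by (auto simp: hd_rev dest: berge_cycle_rev)
  qed
qed

section \<open>Path numbers and connectedness\<close>

text \<open>Reduces the maximum to exhibiting one longest path through \<open>e\<close>; the bound
  \<open>k\<close> on all lengths also makes the set under \<open>Max\<close> finite.\<close>

lemma path_number_eqI:
  assumes "longest_path_length V E k" "berge_path V E vs es" "length es = k" "e \<in> set es"
  shows "path_number V E e = k"
  unfolding path_number_def
proof (rule Max_eqI)
  show "finite {length es |vs es. berge_path V E vs es \<and> e \<in> set es}"
    by (rule finite_subset[of _ "{..k}"]) (use assms(1) in \<open>auto simp: longest_path_length_def\<close>)
qed (use assms in \<open>auto simp: longest_path_length_def\<close>)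

text \<open>A path starting in \<open>T\<close> can never leave it, edge by edge. This turns local
  information about the edges meeting a cycle into a description of all of \<open>V\<close>.\<close>

lemma hyp_connected_closed:
  assumes "hyp_connected V E" "T \<subseteq> V" "T \<noteq> {}"
    and cl: "\<And>e. e \<in> E \<Longrightarrow> e \<inter> T \<noteq> {} \<Longrightarrow> e \<subseteq> T"
  shows "T = V"
proof (rule ccontr)
  assume "T \<noteq> V"
  then obtain u v where uv: "u \<in> T" "v \<in> V" "v \<notin> T" using assms(2,3) by blast
  then obtain vs es where P: "berge_path V E vs es" "hd vs = u" "last vs = v"
    using assms(1,2) unfolding hyp_connected_def by (metis subsetD)
  have "i \<le> length es \<Longrightarrow> vs ! i \<in> T" for i
  proof (induction i)
    case 0
    then show ?case using P uv berge_path_nonempty[OF P(1)] by (simp add: hd_conv_nth)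
  next
    case (Suc i)
    then have "es ! i \<in> E" "vs ! i \<in> es ! i" "vs ! Suc i \<in> es ! i"
      using P(1) by (auto simp: berge_path_def)
    then show ?case using Suc cl[of "es ! i"] by auto
  qed
  moreover have "last vs = vs ! length es"
    using P(1) berge_path_nonempty[OF P(1)] by (simp add: last_conv_nth berge_path_def)
  ultimately show False using P uv by auto
qed

section \<open>The setting: longest path length k with 1 < k \<le> r\<close>

locale longest_berge_path =
  fixes V :: "'a set" and E :: "'a set set" and r k :: nat
  assumes hypergraph: "hypergraph V E" and uniform: "uniform r E" and connected: "hyp_connected V E"
    and longest: "longest_path_length V E k" and k_gt_1: "1 < k" and k_le_r: "k \<le> r"
begin

lemma finite_V: "finite V"
  using hypergraph by (auto simp: hypergraph_def)

lemma edge_subset: "e \<in> E \<Longrightarrow> e \<subseteq> V"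
  using hypergraph by (auto simp: hypergraph_def)

lemma card_edge: "e \<in> E \<Longrightarrow> card e = r"
  using uniform by (auto simp: uniform_def)

lemma finite_edge: "e \<in> E \<Longrightarrow> finite e"
  using finite_V edge_subset finite_subset by blast

lemma finite_E: "finite E"
  using finite_V edge_subset by (meson Pow_iff finite_Pow_iff finite_subset subsetI)

lemma edge_nonempty: "e \<in> E \<Longrightarrow> e \<noteq> {}"
  using card_edge k_gt_1 k_le_r by fastforce

lemma edge_eqI: "e \<in> E \<Longrightarrow> finite A \<Longrightarrow> card A \<le> r \<Longrightarrow> e \<subseteq> A \<Longrightarrow> e = A"
  using card_edge by (metis card_seteq)

lemma path_length_le: "berge_path V E vs es \<Longrightarrow> length es \<le> k"
  using longest by (auto simp: longest_path_length_def)

lemma incident_edges_V: "incident_edges E V = E"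
  using edge_subset edge_nonempty by (fastforce simp: incident_edges_def)

text \<open>A vertex of \<open>g\<close> off the path could be prepended through \<open>g\<close>,
  giving a path of length k + 1.\<close>

lemma path_extend:
  assumes "berge_path V E vs es" "length es = k" "g \<in> E" "g \<notin> set es" "hd vs \<in> g"
  shows "g \<subseteq> set vs"
proof
  fix w assume "w \<in> g"
  show "w \<in> set vs"
  proof (rule ccontr)
    assume "w \<notin> set vs"
    then have "berge_path V E (w # vs) (g # es)"
      using assms edge_subset \<open>w \<in> g\<close> by (intro berge_path_Cons) auto
    then show False using path_length_le assms(2) by fastforce
  qed
qed

lemma cycle_lengths:
  assumes "berge_cycle V E vs es f"
  shows "length vs = Suc (length es)" "distinct vs" "card (set vs) = length vs"
    "card (insert f (set es)) = length vs" "set vs \<subseteq> V" "insert f (set es) \<subseteq> E"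
  using assms by (auto simp: berge_cycle_def berge_path_def distinct_card card_insert_if)

lemma cycle_extend:
  assumes "berge_cycle V E vs es f" "w \<in> f" "w \<notin> set vs"
  shows "berge_path V E (w # vs) (f # es)"
  using assms edge_subset by (intro berge_path_Cons) (auto simp: berge_cycle_def)

section \<open>Cycles of length k + 1\<close>

text \<open>Opening the cycle anywhere gives a longest path. If a cycle edge left the vertex set,
  opening there and prepending the outside vertex would give length k + 1; any other edge at a cycle
  vertex is confined by \<open>path_extend\<close>, with the cycle opened so as to start
  there.\<close>

lemma long_cycle_spans:
  assumes C: "berge_cycle V E vs es f" and l: "length vs = Suc k"
  shows "set vs = V"
proof (rule hyp_connected_closed[OF connected])
  note L = cycle_lengths[OF C]
  show "set vs \<subseteq> V" "set vs \<noteq> {}" using L l by auto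
  fix e assume e: "e \<in> E" "e \<inter> set vs \<noteq> {}"
  show "e \<subseteq> set vs"
  proof
    fix w assume w: "w \<in> e"
    show "w \<in> set vs"
    proof (rule ccontr)
      assume w': "w \<notin> set vs"
      show False
      proof (cases "e \<in> insert f (set es)")
        case True
        then obtain vs' es' where C': "berge_cycle V E vs' es' e" "set vs' = set vs" "length vs' = length vs"
          using berge_cycle_closing_edge[OF C] by metis
        then have "berge_path V E (w # vs') (e # es')" using w w' by (intro cycle_extend) auto
        then show False using path_length_le cycle_lengths(1)[OF C'(1)] C'(3) l by fastforce
      next
        case False
        obtain v where v: "v \<in> e" "v \<in> set vs" using e by auto
        obtain vs' es' f' where C': "berge_cycle V E vs' es' f'" "set vs' = set vs"
          "insert f' (set es') = insert f (set es)" "hd vs' = v" "length vs' = length vs"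
          using berge_cycle_start[OF C v(2)] by metis
        then have "e \<subseteq> set vs'"
          using path_extend[of vs' es' e] cycle_lengths(1)[OF C'(1)] False l e(1) v(1)
          by (auto simp: berge_cycle_def)
        then show False using w w' C' by auto
      qed
    qed
  qed
qed

lemma edges_bound: "card V = Suc r \<Longrightarrow> card E \<le> Suc r"
proof -
  assume V: "card V = Suc r"
  have "card E \<le> card {A. A \<subseteq> V \<and> card A = r}"
    using finite_V edge_subset card_edge by (intro card_mono) auto
  also have "\<dots> = Suc r choose r" using n_subsets[OF finite_V] V by auto
  finally show ?thesis by simp
qed

text \<open>Here \<open>V\<close> has k + 1 vertices. If k < r, every edge would be all of
  \<open>V\<close>, yet the cycle has several edges. So k = r, and the r + 1 cycle edges exhaust the
  r-subsets of an (r + 1)-set that can occur. The closing edge gets its path number from opening the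
  cycle at a different edge.\<close>

lemma long_cycle:
  assumes C: "berge_cycle V E vs es f" and l: "length vs = Suc k"
  shows "k = r" "card V = Suc r" "card E \<le> Suc r" "\<And>e. e \<in> E \<Longrightarrow> path_number V E e = k"
proof -
  note L = cycle_lengths[OF C]
  have V: "set vs = V" using long_cycle_spans[OF C l] .
  have cV: "card V = Suc k" using L(3) V l by simp
  show "k = r"
  proof (rule ccontr)
    assume "k \<noteq> r"
    then have "\<And>e. e \<in> E \<Longrightarrow> e = V"
      using edge_eqI[OF _ finite_V] edge_subset cV k_le_r by simp
    then have "insert f (set es) \<subseteq> {V}" using L(6) by blast
    then have "card (insert f (set es)) \<le> card {V}" by (intro card_mono) auto
    then show False using L(4) l k_gt_1 by simp
  qed
  then show cV: "card V = Suc r" using cV by simp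
  show cE: "card E \<le> Suc r" using edges_bound[OF cV] .
  have E: "insert f (set es) = E"
    using L(4,6) l cE \<open>k = r\<close> finite_E by (intro card_seteq) auto
  fix e assume e: "e \<in> E"
  have P: "berge_path V E vs es" "length es = k" using C L l by (auto simp: berge_cycle_def)
  show "path_number V E e = k"
  proof (cases "e = f")
    case False
    then show ?thesis using path_number_eqI[OF longest P] e E by auto
  next
    case True
    have "es \<noteq> []" using P k_gt_1 by auto
    then obtain e' where e': "e' \<in> set es" by (cases es) auto
    then obtain vs' es' where C': "berge_cycle V E vs' es' e'" "insert e' (set es') = insert f (set es)"
      "length vs' = length vs"
      using berge_cycle_closing_edge[OF C, of e'] by (metis insertCI)
    have "e \<in> set es'" using C C' e' True by (auto simp: berge_cycle_def)
    then show ?thesis using path_number_eqI[OF longest, of vs' es'] C' cycle_lengths(1)[OF C'(1)] l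
      by (auto simp: berge_cycle_def)
  qed
qed

section \<open>Edges at the end of a longest path\<close>

lemma card_two_edges:
  assumes "e \<in> E" "e' \<in> E" "e \<noteq> e'" "e \<subseteq> T" "e' \<subseteq> T" "finite T"
  shows "Suc r \<le> card T"
  using edge_eqI[OF assms(1,6)] edge_eqI[OF assms(2,6)] assms(3-5) by (metis not_less_eq_eq)

text \<open>The edge stays within the path's vertices. If it misses the last one, it fits into k
  \<le> r vertices and so equals that set; in particular it contains both ends of the shortened
  path.\<close>

lemma end_edge:
  assumes P: "berge_path V E vs es" "length es = k" and g: "g \<in> E" "hd vs \<in> g" "g \<notin> set es"
  shows "berge_cycle V E vs es g \<or> k = r \<and> berge_cycle V E (butlast vs) (butlast es) g"
proof (cases "last vs \<in> g")
  case True
  then show ?thesis using P g by (auto simp: berge_cycle_def)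
next
  case False
  have sub: "g \<subseteq> set vs" using path_extend P g by auto
  have ne: "vs \<noteq> []" "es \<noteq> []" using P k_gt_1 berge_path_nonempty by auto
  have lvs: "length vs = Suc k" "distinct vs" using P by (auto simp: berge_path_def)
  obtain q v where q: "vs = q @ [v]" using ne by (metis append_butlast_last_id)
  obtain eb e where eb: "es = eb @ [e]" using ne by (metis append_butlast_last_id)
  have l: "length q = Suc (length eb)" using P q eb by (auto simp: berge_path_def)
  have Q: "berge_path V E q eb" "last q \<in> e"
    using P berge_path_append_iff[OF l, of "[v]" "[]" V E e] by (auto simp: q eb)
  have "g \<subseteq> set q" using sub False q by auto
  moreover have "card (set q) = k" using lvs q by (simp add: distinct_card)
  ultimately have "g = set q" using edge_eqI[OF g(1)] k_le_r by simp
  then have "k = r" using card_edge[OF g(1)] \<open>card (set q) = k\<close> by simp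
  moreover have "q \<noteq> []" using l by auto
  then have "berge_cycle V E q eb g"
    using Q g \<open>g = set q\<close> eb by (auto simp: berge_cycle_def)
  ultimately show ?thesis using q eb by simp
qed

text \<open>Both alternatives of \<open>end_edge\<close> force k = r, the first one by
  \<open>long_cycle\<close>.\<close>

lemma end_edge_short:
  assumes "k < r" "berge_path V E vs es" "length es = k" "g \<in> E" "hd vs \<in> g"
  shows "g \<in> set es"
proof (rule ccontr)
  assume "g \<notin> set es"
  then have "berge_cycle V E vs es g" using end_edge assms by fastforce
  then show False using long_cycle(1)[of vs es g] assms by (auto simp: berge_path_def)
qed

section \<open>Cycles of length k < r\<close>

text \<open>Every vertex of the union is an end of a longest path with edge set \<open>F\<close>, so
  \<open>end_edge_short\<close> applies to all of them. From a vertex off the cycle, the path enters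
  the cycle through an edge containing it. From a cycle vertex, it runs around the cycle and leaves
  through the closing edge, which is too large to stay inside the k cycle vertices.\<close>

lemma cycle_short:
  assumes "k < r" and C: "berge_cycle V E vs es f" and l: "length vs = k"
  defines "F \<equiv> insert f (set es)"
  shows "\<Union>F \<subseteq> V" "Suc r \<le> card (\<Union>F)" "incident_edges E (\<Union>F) \<subseteq> F" "card F = k"
    "\<And>e. e \<in> F \<Longrightarrow> path_number V E e = k"
proof -
  note L = cycle_lengths[OF C, folded F_def]
  show UV: "\<Union>F \<subseteq> V" using L(6) edge_subset by auto
  show cF: "card F = k" using L l by simp
  have "es \<noteq> []" using L l k_gt_1 by auto
  then obtain e where e: "e \<in> set es" by (cases es) auto
  then show "Suc r \<le> card (\<Union>F)"
    using C L(6) finite_subset[OF UV finite_V]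
    by (intro card_two_edges[of f e]) (auto simp: F_def berge_cycle_def)
  have ends: "\<exists>us fs. berge_path V E us fs \<and> length fs = k \<and> set fs = F \<and> hd us = v" if v: "v \<in> \<Union>F" for v
  proof (cases "v \<in> set vs")
    case True
    obtain vs' es' f' where C': "berge_cycle V E vs' es' f'" "set vs' = set vs"
      "insert f' (set es') = F" "hd vs' = v" "length vs' = length vs"
      using berge_cycle_start[OF C True] unfolding F_def by metis
    have "\<not> f' \<subseteq> set vs'"
      using card_mono[of "set vs'" f'] card_edge[of f'] cycle_lengths(3)[OF C'(1)] C' l \<open>k < r\<close>
      by (auto simp: berge_cycle_def)
    then obtain w where "w \<in> f'" "w \<notin> set (rev vs')" by auto
    from berge_path_rev[OF cycle_extend[OF berge_cycle_rev[OF C'(1)] this]]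
    have "berge_path V E (vs' @ [w]) (es' @ [f'])" by simp
    moreover have "vs' \<noteq> []" using C' L l by auto
    ultimately show ?thesis
      using C' cycle_lengths(1)[OF C'(1)] l
      by (intro exI[of _ "vs' @ [w]"] exI[of _ "es' @ [f']"]) auto
  next
    case False
    obtain e where e: "e \<in> F" "v \<in> e" using v by auto
    then obtain vs' es' where C': "berge_cycle V E vs' es' e" "set vs' = set vs" "length vs' = length vs"
      "insert e (set es') = F"
      using berge_cycle_closing_edge[OF C, of e] unfolding F_def by metis
    then have "berge_path V E (v # vs') (e # es')" using e False by (intro cycle_extend) auto
    then show ?thesis
      using C' cycle_lengths(1)[OF C'(1)] l
      by (intro exI[of _ "v # vs'"] exI[of _ "e # es'"]) auto
  qed
  show "incident_edges E (\<Union>F) \<subseteq> F"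
  proof
    fix g assume "g \<in> incident_edges E (\<Union>F)"
    then obtain v where "v \<in> \<Union>F" "v \<in> g" "g \<in> E" by (auto simp: incident_edges_def)
    then show "g \<in> F" using ends[of v] end_edge_short[OF \<open>k < r\<close>, of _ _ g] by blast
  qed
  fix e assume "e \<in> F"
  then obtain v where "v \<in> \<Union>F" using edge_nonempty L(6) by blast
  then show "path_number V E e = k"
    using ends[of v] path_number_eqI[OF longest, of _ _ e] \<open>e \<in> F\<close> by blast
qed

section \<open>Cycles of length k = r\<close>

text \<open>
  Every vertex \<open>w\<close> outside a cycle of length \<open>k = r\<close> that lies in one of its edges starts a longest
  path whose other vertices are those of the cycle. Hence the edges outside the cycle stay within the cycle
  and at most one further such \<open>w\<close>; two distinct \<open>w\<close> exclude each other's edges.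
\<close>

lemma cycle_spanning:
  assumes "k = r" and r3: "3 \<le> r" and C: "berge_cycle V E vs es f" and l: "length vs = k"
  shows "Suc r \<le> card V" "card E \<le> Suc r" "\<And>e. e \<in> E \<Longrightarrow> path_number V E e = k"
proof -
  define F where "F = insert f (set es)"
  define U where "U = set vs"
  define W where "W = \<Union>F - U"
  note L = cycle_lengths[OF C, folded F_def U_def]
  have FE: "F \<subseteq> E" and UV: "U \<subseteq> V" using L by auto
  have finU: "finite U" and cU: "card U = r" using L l \<open>k = r\<close> by (auto simp: U_def)
  have cF: "card F = r" using L l \<open>k = r\<close> by simp
  \<comment> \<open>Cycle edges and \<open>U\<close> both have r elements, so the only edge that
    cannot leave the cycle is \<open>U\<close> itself. This exceptional edge causes the case
    distinctions below.\<close>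
  have out: "e = U \<or> (\<exists>w\<in>W. w \<in> e)" if "e \<in> F" for e
    using edge_eqI[of e U] finU cU that FE by (auto simp: W_def)
  define cyc where "cyc vs' es' f' \<longleftrightarrow> berge_cycle V E vs' es' f' \<and> set vs' = U \<and>
    insert f' (set es') = F \<and> length es' = r - 1" for vs' es' f'
  have cycI: "cyc vs' es' f'" if "berge_cycle V E vs' es' f'" "set vs' = set vs"
    "insert f' (set es') = insert f (set es)" "length vs' = length vs" for vs' es' f'
    using that L l cycle_lengths(1)[OF that(1)] \<open>k = r\<close> by (auto simp: cyc_def U_def F_def)
  have cyc_rev: "cyc (rev vs') (rev es') f'" if "cyc vs' es' f'" for vs' es' f'
    using that by (auto simp: cyc_def intro: berge_cycle_rev)
  have close: "\<exists>vs' es'. cyc vs' es' e" if "e \<in> F" for e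
    using berge_cycle_closing_edge[OF C, of e] that cycI unfolding F_def by metis
  have start: "\<exists>vs' es' f'. cyc vs' es' f' \<and> hd vs' = v" if "v \<in> U" for v
    using berge_cycle_start[OF C, of v] that cycI unfolding U_def by metis
  have ext: "berge_path V E (w # vs') (f' # es')" "length (f' # es') = k"
    if "cyc vs' es' f'" "w \<in> f'" "w \<in> W" for w vs' es' f'
    using that cycle_extend[of vs' es' f' w] k_gt_1 \<open>k = r\<close> by (auto simp: cyc_def W_def)
  have out_W: "g \<subseteq> insert w U" if w: "w \<in> W" and "w \<in> g" "g \<in> E" "g \<notin> F" for w g
  proof -
    obtain e where e: "e \<in> F" "w \<in> e" using w by (auto simp: W_def)
    then obtain vs' es' where c: "cyc vs' es' e" using close by blast
    show ?thesis using path_extend[OF ext[OF c e(2) w] that(3)] that c by (auto simp: cyc_def)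
  qed
  \<comment> \<open>Since \<open>w # vs'\<close> is a longest path on \<open>w\<close> and
    \<open>U\<close>, an edge outside \<open>F\<close> at its end \<open>last vs'\<close> stays in
    \<open>insert w U\<close>. Reversing the cycle gives the same at \<open>hd vs'\<close>.\<close>
  have out_cyc: "g \<subseteq> insert w U"
    if c: "cyc vs' es' f'" and w: "w \<in> W" "w \<in> f'" and g: "hd vs' \<in> g \<or> last vs' \<in> g" "g \<in> E" "g \<notin> F"
    for w vs' es' f' g
  proof -
    have *: "g \<subseteq> insert w U" if c: "cyc vs' es' f'" and "last vs' \<in> g" for vs' es'
    proof -
      have "vs' \<noteq> []" using c by (auto simp: cyc_def berge_cycle_def dest: berge_path_nonempty)
      then show ?thesis
        using path_extend[OF berge_path_rev[OF ext(1)[OF c w(2,1)]], of g] ext(2)[OF c w(2,1)] that g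
        by (auto simp: cyc_def hd_append hd_rev)
    qed
    show ?thesis using g(1) *[OF c] *[OF cyc_rev[OF c]] by (auto simp: last_rev)
  qed
  have out_U: "\<exists>w\<in>W. g \<subseteq> insert w U" if "v \<in> U" "v \<in> g" and g: "g \<in> E" "g \<notin> F" for v g
  proof -
    obtain vs' es' f' where c: "cyc vs' es' f'" "hd vs' = v" using start[OF \<open>v \<in> U\<close>] by blast
    show ?thesis
    proof (cases "f' = U")
      case False
      then obtain w where "w \<in> W" "w \<in> f'" using out[of f'] c by (auto simp: cyc_def)
      then show ?thesis using out_cyc[OF c(1)] g that c(2) by blast
    next
      \<comment> \<open>The closing edge at \<open>v\<close> does not reach \<open>W\<close>. The
        other cycle edge at \<open>v\<close>, \<open>es' ! 0\<close>, differs from \<open>U\<close>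
        and does, so the cycle is opened there, with \<open>v\<close> as the last vertex.\<close>
      case True
      obtain q where q: "vs' = v # q"
        using c by (cases vs') (auto simp: cyc_def berge_cycle_def dest: berge_path_nonempty)
      have C': "berge_cycle V E vs' es' f'" "length es' = r - 1" using c by (auto simp: cyc_def)
      then have i: "0 < length es'" using r3 by simp
      obtain vs2 es2 where c2: "berge_cycle V E vs2 es2 (es' ! 0)" "set vs2 = set vs'"
        "insert (es' ! 0) (set es2) = insert f' (set es')" "last vs2 = vs' ! 0" "length vs2 = length vs'"
        using berge_cycle_rotate[OF C'(1) i] by metis
      have "cyc vs2 es2 (es' ! 0)"
        using c c2 cycle_lengths(1)[OF c2(1)] cycle_lengths(1)[OF C'(1)] by (auto simp: cyc_def)
      moreover have "es' ! 0 \<noteq> U" using C' i True by (auto simp: berge_cycle_def)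
      moreover have "es' ! 0 \<in> F" using \<open>cyc vs2 es2 (es' ! 0)\<close> by (auto simp: cyc_def)
      ultimately obtain w where w: "w \<in> W" "w \<in> es' ! 0" using out[of "es' ! 0"] by blast
      have "last vs2 \<in> g" using c2(4) q that(2) by simp
      then have "g \<subseteq> insert w U" using out_cyc[OF \<open>cyc vs2 es2 (es' ! 0)\<close> w _ g] by simp
      then show ?thesis using w by blast
    qed
  qed
  obtain e1 where e1: "e1 \<in> F" "e1 \<noteq> U"
  proof -
    have "\<not> F \<subseteq> {U}" using card_mono[of "{U}" F] cF r3 by auto
    then show thesis using that by blast
  qed
  then obtain w1 where w1: "w1 \<in> W" "w1 \<in> e1" using out by blast
  have W: "W \<subseteq> V" using FE edge_subset by (auto simp: W_def)
  have V: "U \<union> W = V"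
  proof (rule hyp_connected_closed[OF connected])
    show "U \<union> W \<subseteq> V" "U \<union> W \<noteq> {}" using W UV w1 by auto
    fix g assume g: "g \<in> E" "g \<inter> (U \<union> W) \<noteq> {}"
    show "g \<subseteq> U \<union> W"
    proof (cases "g \<in> F")
      case False
      obtain v where v: "v \<in> g" "v \<in> U \<or> v \<in> W" using g(2) by blast
      then have "\<exists>w\<in>W. g \<subseteq> insert w U"
        using out_W[OF _ v(1) g(1) False] out_U[OF _ v(1) g(1) False] by auto
      then show ?thesis by auto
    qed (auto simp: W_def)
  qed
  have disj: "U \<inter> W = {}" by (auto simp: W_def)
  have finW: "finite W" using W finite_V finite_subset by blast
  have cV: "card V = r + card W" using card_Un_disjoint[OF finU finW disj] V cU by simp
  have "card W > 0" using w1 finW by (auto simp: card_gt_0_iff)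
  then show "Suc r \<le> card V" using cV by simp
  have nonF: "\<exists>w\<in>W. g \<subseteq> insert w U" if g: "g \<in> E" "g \<notin> F" for g
  proof -
    obtain v where "v \<in> g" using edge_nonempty[OF g(1)] by blast
    then have "v \<in> U \<or> v \<in> W" using V edge_subset[OF g(1)] by blast
    then show ?thesis using out_W[OF _ \<open>v \<in> g\<close> g] out_U[OF _ \<open>v \<in> g\<close> g] by auto
  qed
  show "card E \<le> Suc r"
  proof (cases "W = {w1}")
    case True
    then show ?thesis using edges_bound cV by simp
  next
    case False
    then obtain w2 where w2: "w2 \<in> W" "w2 \<noteq> w1" using w1 by blast
    have "g = U" if g: "g \<in> E" "g \<notin> F" for g
    proof -
      obtain w where w: "w \<in> W" "g \<subseteq> insert w U" using nonF[OF g] by blast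
      \<comment> \<open>If \<open>w \<in> g\<close>, open the cycle at an edge containing another
        \<open>w'\<close>. By \<open>out_cyc\<close>, \<open>g\<close> must miss both ends of the
        opened cycle, for otherwise it would lie in \<open>insert w' U\<close>. Then
        \<open>g\<close> has at most 1 + (r - 2) elements.\<close>
      have "w \<notin> g"
      proof
        assume "w \<in> g"
        obtain w' where w': "w' \<in> W" "w' \<noteq> w" using w1 w2 by metis
        then obtain e where e: "e \<in> F" "w' \<in> e" by (auto simp: W_def)
        then obtain vs' es' where c: "cyc vs' es' e" using close by blast
        have "hd vs' \<notin> g" "last vs' \<notin> g"
          using out_cyc[OF c w'(1) e(2) _ g] \<open>w \<in> g\<close> w' w disj by blast+
        moreover have "vs' \<noteq> []" and "set vs' = U"
          using c by (auto simp: cyc_def berge_cycle_def dest: berge_path_nonempty)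
        moreover have "length vs' = r" "distinct vs'"
          using c cycle_lengths(1)[of vs' es' e] cycle_lengths(2)[of vs' es' e] r3
          by (auto simp: cyc_def)
        then have "hd vs' \<noteq> last vs'"
          using r3 \<open>vs' \<noteq> []\<close> by (auto simp: hd_conv_nth last_conv_nth nth_eq_iff_index_eq)
        ultimately have "g \<subseteq> insert w (U - {hd vs', last vs'})" "card {hd vs', last vs'} = 2"
          "{hd vs', last vs'} \<subseteq> U"
          using w by auto
        then have "card g \<le> card (insert w (U - {hd vs', last vs'}))"
          "card (U - {hd vs', last vs'}) = r - 2"
          using finU cU by (auto intro!: card_mono simp: card_Diff_subset)
        then have "card g \<le> Suc (r - 2)"
          using card_insert_le_m1 finU by (metis (no_types, lifting) card_insert_if finite_Diff le_SucI order_trans order_refl)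
        then show False using card_edge[OF g(1)] r3 by simp
      qed
      then have "g \<subseteq> U" using w by auto
      then show "g = U" using edge_eqI[OF g(1) finU] cU by simp
    qed
    then have "E \<subseteq> insert U F" by blast
    then have "card E \<le> card (insert U F)" by (intro card_mono) (auto simp: F_def)
    then show ?thesis using cF by (metis card_insert_le_m1 card_insert_if Suc_leD le_Suc_eq F_def finite.insertI finite_set order_trans)
  qed
  fix g assume g: "g \<in> E"
  show "path_number V E g = k"
  proof (cases "g \<in> F")
    case True
    obtain vs' es' where c: "cyc vs' es' e1" using close[OF e1(1)] by blast
    show ?thesis
      using path_number_eqI[OF longest ext[OF c w1(2,1)]] True c by (auto simp: cyc_def)
  next
    case False
    obtain w where w: "w \<in> W" "g \<subseteq> insert w U" using nonF[OF g False] by blast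
    show ?thesis
    proof (cases "w \<in> g")
      case True
      have "\<not> g \<subseteq> {w}" using card_mono[of "{w}" g] card_edge[OF g] r3 by auto
      then obtain u where u: "u \<in> U" "u \<in> g" using w by blast
      then obtain vs' es' f' where c: "cyc vs' es' f'" "hd vs' = u" using start by blast
      have "berge_path V E (w # vs') (g # es')"
        using c u True w disj W g False by (intro berge_path_Cons) (auto simp: cyc_def berge_cycle_def)
      then show ?thesis using c r3 \<open>k = r\<close>
        by (intro path_number_eqI[OF longest, of "w # vs'" "g # es'"]) (auto simp: cyc_def)
    next
      \<comment> \<open>The edge \<open>U\<close> contains every cycle vertex, so it can replace the
        last edge of a longest path that enters the cycle from \<open>w1\<close>.\<close>
      case wg: False
      then have gU: "g = U" using edge_eqI[OF g finU] cU w by auto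
      obtain vs' es' where c: "cyc vs' es' e1" using close[OF e1(1)] by blast
      have P: "berge_path V E (w1 # vs') (e1 # es')" "length (e1 # es') = k"
        using ext[OF c w1(2,1)] .
      have "length es' \<noteq> 0" using c r3 by (auto simp: cyc_def)
      then obtain eb e where eb: "es' = eb @ [e]" by (metis append_butlast_last_id list.size(3))
      have "length vs' = Suc (length es')" using c by (auto simp: cyc_def berge_cycle_def berge_path_def)
      then obtain q v where q: "vs' = q @ [v]" "q \<noteq> []" using eb
        by (metis append_butlast_last_id append_self_conv2 length_0_conv length_append_singleton nat.simps(3) nat.inject)
      have lq: "length (w1 # q) = Suc (length (e1 # eb))"
        using \<open>length vs' = Suc (length es')\<close> eb q by simp
      have "berge_path V E ((w1 # q) @ [v]) ((e1 # eb) @ e # [])" using P eb q by simp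
      moreover have qU: "set q \<subseteq> U" "v \<in> U" using c q by (auto simp: cyc_def)
      moreover have "last q \<in> U" using qU q(2) by auto
      moreover have "g \<notin> set (e1 # eb)" using c eb False by (auto simp: cyc_def)
      ultimately have "berge_path V E ((w1 # q) @ [v]) ((e1 # eb) @ g # [])"
        using q g gU by (subst (asm) berge_path_append_iff[OF lq], simp)
          (subst berge_path_append_iff[OF lq], auto)
      then show ?thesis using P eb
        by (intro path_number_eqI[OF longest, of "(w1 # q) @ [v]" "(e1 # eb) @ g # []"]) auto
    qed
  qed
qed

section \<open>No cycles of length k or k + 1: counting the ends\<close>

text \<open>
  The ends of the paths with edge set \<open>set es\<close> are found at three places: all vertices of the first edge
  not in \<open>set (tl vs)\<close>; the last vertex; and, for every other \<open>vs ! Suc i\<close> in the first edge, one more end,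
  which is a vertex of \<open>es ! i\<close> not in \<open>set (tl vs)\<close>, or \<open>vs ! i\<close> if such a vertex could be counted before.
\<close>

lemma acyclic_ends:
  assumes no_cycle: "\<forall>vs es f. berge_cycle V E vs es f \<longrightarrow> length vs \<noteq> k \<and> length vs \<noteq> Suc k"
    and P: "berge_path V E vs es" and len: "length es = k"
  defines "S \<equiv> {v. \<exists>us fs. berge_path V E us fs \<and> set fs = set es \<and> hd us = v}"
  shows "S \<subseteq> V" "r \<le> card S" "k < r \<Longrightarrow> Suc r \<le> card S" "incident_edges E S \<subseteq> set es"
proof -
  have nc: "length us \<noteq> k" and nc1: "length us \<noteq> Suc k" if "berge_cycle V E us fs h" for us fs h
    using no_cycle that by blast+
  have SI: "hd us \<in> S" if "berge_path V E us fs" "set fs = set es" for us fs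
    using that by (auto simp: S_def)
  have lenS: "length fs = k" if "berge_path V E us fs" "set fs = set es" for us fs
    using that P len by (metis berge_path_def distinct_card)
  show SV: "S \<subseteq> V"
  proof
    fix v assume "v \<in> S"
    then obtain us fs where u: "berge_path V E us fs" "hd us = v" by (auto simp: S_def)
    then have "v \<in> set us" using berge_path_nonempty[OF u(1)] by auto
    then show "v \<in> V" using u(1) by (auto simp: berge_path_def)
  qed
  then have finS: "finite S" using finite_V finite_subset by blast
  show "incident_edges E S \<subseteq> set es"
  proof
    fix g assume "g \<in> incident_edges E S"
    then obtain us fs where u: "g \<in> E" "berge_path V E us fs" "set fs = set es" "hd us \<in> g"
      by (auto simp: incident_edges_def S_def)
    then have l: "length fs = k" "length us = Suc k"
      using lenS[OF u(2,3)] by (auto simp: berge_path_def)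
    show "g \<in> set es"
    proof (rule ccontr)
      assume "g \<notin> set es"
      then have "berge_cycle V E us fs g \<or> berge_cycle V E (butlast us) (butlast fs) g"
        using end_edge[OF u(2) l(1) u(1,4)] u(3) by auto
      then show False using nc[of "butlast us" "butlast fs" g] nc1[of us fs g] l by auto
    qed
  qed
  have lvs: "length vs = Suc k" "distinct vs" "distinct es" "set es \<subseteq> E"
    and inc: "\<And>i. i < k \<Longrightarrow> vs ! i \<in> es ! i \<and> vs ! Suc i \<in> es ! i"
    using P len by (auto simp: berge_path_def)
  have ne: "vs \<noteq> []" "es \<noteq> []" using lvs len k_gt_1 by auto
  have esE: "es ! i \<in> E" if "i < k" for i using that len lvs(4) by auto
  have tl: "set (tl vs) = (\<lambda>i. vs ! Suc i) ` {..<k}" "card (set (tl vs)) = k"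
  proof -
    show "set (tl vs) = (\<lambda>i. vs ! Suc i) ` {..<k}"
      using lvs(1) by (force simp: in_set_conv_nth nth_tl image_iff)
    show "card (set (tl vs)) = k" using lvs by (simp add: distinct_card distinct_tl)
  qed
  \<comment> \<open>The positions at which \<open>es ! 0\<close> permits a rerouting; 0 stands for
    merely dropping the first vertex.\<close>
  define X where "X = {i. i < k \<and> vs ! Suc i \<in> es ! 0}"
  \<comment> \<open>A rerouted path occupies exactly \<open>set (tl vs)\<close>, so these are the
    vertices of \<open>e\<close> that can be prepended to it.\<close>
  define free where "free e = e - set (tl vs)" for e
  have X0: "0 \<in> X" and finX: "finite X" using k_gt_1 inc by (auto simp: X_def)
  have route: "\<exists>us fs. berge_path V E us fs \<and> set us = set (tl vs) \<and> length fs = k - 1 \<and>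
      es ! i \<notin> set fs \<and> set es = insert (es ! i) (set fs) \<and> hd us \<in> es ! i \<and> last us = vs ! k \<and>
      drop i us = drop (Suc i) vs \<and> drop i fs = drop (Suc i) es" if "i \<in> X" for i
  proof -
    have "i < length es" "vs ! Suc i \<in> es ! 0" using that len by (auto simp: X_def)
    moreover have "last vs = vs ! k" using ne lvs by (simp add: last_conv_nth)
    ultimately show ?thesis using berge_path_reroute[OF P, of i] len by metis
  qed
  \<comment> \<open>Otherwise, by size, the edge would be the whole vertex set of the rerouted path
    and close it to a cycle of length \<open>k\<close>.\<close>
  have free_ne: "free (es ! i) \<noteq> {}" if i: "i \<in> X" for i
  proof
    assume "free (es ! i) = {}"
    then have "es ! i \<subseteq> set (tl vs)" by (auto simp: free_def)
    moreover have "es ! i \<in> E" using i esE by (auto simp: X_def)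
    ultimately have eq: "es ! i = set (tl vs)" using edge_eqI tl(2) k_le_r by simp
    obtain us fs where u: "berge_path V E us fs" "set us = set (tl vs)" "length fs = k - 1"
      "es ! i \<notin> set fs" "hd us \<in> es ! i"
      using route[OF i] by blast
    then have "last us \<in> es ! i" using eq berge_path_nonempty[OF u(1)] by auto
    then have "berge_cycle V E us fs (es ! i)" using u \<open>es ! i \<in> E\<close> by (auto simp: berge_cycle_def)
    then show False using nc[of us fs] u(1,3) k_gt_1 by (auto simp: berge_path_def)
  qed
  \<comment> \<open>Beyond position \<open>i\<close> all vertices and edges keep their indices,
    which allows a second rotation at a later index.\<close>
  have route_free: "\<exists>us fs. berge_path V E (w # us) (es ! i # fs) \<and> set (es ! i # fs) = set es \<and>
      (\<forall>j>i. j < k \<longrightarrow> (w # us) ! j = vs ! j \<and> (es ! i # fs) ! j = es ! j)"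
    if i: "i \<in> X" and w: "w \<in> free (es ! i)" for i w
  proof -
    obtain us fs where u: "berge_path V E us fs" "set us = set (tl vs)" "length fs = k - 1"
      "es ! i \<notin> set fs" "set es = insert (es ! i) (set fs)" "hd us \<in> es ! i"
      "drop i us = drop (Suc i) vs" "drop i fs = drop (Suc i) es"
      using route[OF i] by blast
    have "i < k" using i by (simp add: X_def)
    have "berge_path V E (w # us) (es ! i # fs)"
      using u w esE[OF \<open>i < k\<close>] edge_subset[OF esE[OF \<open>i < k\<close>]]
      by (intro berge_path_Cons) (auto simp: free_def)
    moreover have "(w # us) ! j = vs ! j \<and> (es ! i # fs) ! j = es ! j" if j: "i < j" "j < k" for j
    proof -
      obtain d where d: "j = Suc (i + d)" using less_imp_Suc_add[OF j(1)] by blast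
      have "length us = k" using u(1,3) k_gt_1 by (auto simp: berge_path_def)
      then have "us ! (i + d) = drop i us ! d" "fs ! (i + d) = drop i fs ! d"
        using j d u(3) by (auto simp: nth_drop)
      then show ?thesis using u(7,8) d j len lvs by (simp add: nth_drop)
    qed
    ultimately show ?thesis using u by (intro exI[of _ us] exI[of _ fs]) auto
  qed
  have free_S: "w \<in> S" if a: "i \<in> X" "w \<in> free (es ! i)" for i w
  proof -
    obtain us fs where "berge_path V E (w # us) (es ! i # fs)" "set (es ! i # fs) = set es"
      using route_free[OF a] by blast
    then show ?thesis using SI by fastforce
  qed
  \<comment> \<open>Enter at \<open>w\<close> through \<open>es ! j\<close>. Since \<open>w\<close>
    also lies in the later edge \<open>es ! i\<close>, rotating the new path there makes
    \<open>vs ! i\<close> an end.\<close>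
  have nth_S: "vs ! i \<in> S" if a: "j \<in> X" "j < i" "i < k" "w \<in> free (es ! j)" "w \<in> free (es ! i)" for i j w
  proof -
    obtain us fs where u: "berge_path V E (w # us) (es ! j # fs)" "set (es ! j # fs) = set es"
      "(w # us) ! i = vs ! i" "(es ! j # fs) ! i = es ! i"
      using route_free[OF a(1,4)] a by blast
    have "i < length (es ! j # fs)" using lenS[OF u(1,2)] a by simp
    then show ?thesis
      using berge_path_rotate[OF u(1), of i] u SI a(5) by (metis Diff_iff free_def list.sel(1))
  qed
  have last_S: "vs ! k \<in> S"
    using SI[OF berge_path_rev[OF P]] ne lvs by (simp add: hd_rev last_conv_nth)
  \<comment> \<open>If the first vertex were in the last edge, dropping the last vertex would leave
    a path that this edge closes to a cycle of length \<open>k\<close>.\<close>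
  have no_return: "hd us \<notin> last fs" if u: "berge_path V E us fs" "length fs = k" for us fs
  proof
    assume h: "hd us \<in> last fs"
    have "us \<noteq> []" "fs \<noteq> []" using u k_gt_1 berge_path_nonempty by auto
    then obtain q v fb f where q: "us = q @ [v]" "fs = fb @ [f]" by (metis append_butlast_last_id)
    then have l: "length q = Suc (length fb)" using u by (auto simp: berge_path_def)
    moreover have "q \<noteq> []" using l by auto
    ultimately have "berge_cycle V E q fb f"
      using u h berge_path_append_iff[OF l, of "[v]" "[]" V E f] q by (auto simp: berge_cycle_def)
    then show False using nc[of q fb f] l q u by auto
  qed
  have free_last: "w \<notin> es ! (k - 1)" if a: "i \<in> X" "w \<in> free (es ! i)" for i w
  proof (cases "i = k - 1")
    \<comment> \<open>This case is contradictory: the rerouted path ends in \<open>vs ! k\<close>,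
      which lies in \<open>es ! (k - 1)\<close>, so that edge would close a cycle of length
      \<open>k\<close>.\<close>
    case True
    obtain us fs where u: "berge_path V E us fs" "length fs = k - 1"
      "es ! i \<notin> set fs" "hd us \<in> es ! i" "last us = vs ! k"
      using route[OF a(1)] by blast
    have "vs ! k \<in> es ! i" "es ! i \<in> E" using inc[of i] esE[of i] True k_gt_1 by auto
    then have "berge_cycle V E us fs (es ! i)" using u by (auto simp: berge_cycle_def)
    then show ?thesis using nc[of us fs] u(1,2) k_gt_1 by (auto simp: berge_path_def)
  next
    case False
    then have "i < k - 1" using a by (auto simp: X_def)
    then obtain us fs where u: "berge_path V E (w # us) (es ! i # fs)" "set (es ! i # fs) = set es"
      "(es ! i # fs) ! (k - 1) = es ! (k - 1)"
      using route_free[OF a] k_gt_1 by (metis diff_less less_imp_not_less not_less_zero zero_less_one less_trans neq0_conv)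
    have "last (es ! i # fs) = (es ! i # fs) ! (length (es ! i # fs) - 1)"
      by (rule last_conv_nth) simp
    then have "last (es ! i # fs) = es ! (k - 1)" using u(3) lenS[OF u(1,2)] by metis
    then show ?thesis using no_return[OF u(1) lenS[OF u(1,2)]] by simp
  qed
  \<comment> \<open>A free vertex of \<open>es ! i\<close> may already have been offered at a
    smaller index. Then \<open>vs ! i\<close> serves as a substitute: it belongs to
    \<open>tl vs\<close> and is therefore never free. Indices that are not \<open>earlier\<close>
    have pairwise disjoint free sets.\<close>
  define earlier where "earlier i \<longleftrightarrow> (\<exists>j\<in>X. j < i \<and> free (es ! j) \<inter> free (es ! i) \<noteq> {})" for i
  define g where "g i = (if earlier i then vs ! i else (SOME w. w \<in> free (es ! i)))" for i
  have g_free: "g i \<in> free (es ! i)" if "i \<in> X" "\<not> earlier i" for i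
    using some_in_eq[of "free (es ! i)"] free_ne[OF that(1)] that(2) by (simp add: g_def)
  have g_S: "g i \<in> S" if i: "i \<in> X" for i
  proof (cases "earlier i")
    case True
    then obtain j w where "j \<in> X" "j < i" "w \<in> free (es ! j)" "w \<in> free (es ! i)"
      by (auto simp: earlier_def)
    then have "vs ! i \<in> S" using nth_S i by (auto simp: X_def)
    then show ?thesis using True by (simp add: g_def)
  qed (use i g_free free_S in blast)
  have nth_tl_vs: "vs ! i \<in> set (tl vs)" if "0 < i" "i \<le> k" for i
    using that tl(1) by (auto intro!: image_eqI[of _ _ "i - 1"])
  have nth_not_free: "vs ! i \<notin> free e" if "0 < i" "i \<le> k" for i e
    using nth_tl_vs[OF that] by (simp add: free_def)
  have g_inj: "inj_on g (X - {0})"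
  proof (rule linorder_inj_onI')
    fix i j assume ij: "i \<in> X - {0}" "j \<in> X - {0}" "i < j"
    then have *: "0 < i" "i \<le> k" "0 < j" "j \<le> k" by (auto simp: X_def)
    show "g i \<noteq> g j"
    proof (cases "earlier i"; cases "earlier j")
      assume "earlier i" "earlier j"
      then show ?thesis using ij * lvs by (auto simp: g_def nth_eq_iff_index_eq)
    next
      assume "\<not> earlier i" "\<not> earlier j"
      then have "g i \<in> free (es ! i)" "g j \<in> free (es ! j)" "free (es ! i) \<inter> free (es ! j) = {}"
        using g_free[of i] g_free[of j] ij by (auto simp: earlier_def)
      then show ?thesis by auto
    next
      assume e: "earlier i" "\<not> earlier j"
      then show ?thesis using g_free[of j] ij nth_not_free[OF *(1,2)] by (metis DiffD1 g_def)
    next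
      assume e: "\<not> earlier i" "earlier j"
      then show ?thesis using g_free[of i] ij nth_not_free[OF *(3,4)] by (metis DiffD1 g_def)
    qed
  qed
  define N where "N = free (es ! 0)"
  have e0: "es ! 0 \<in> E" using esE k_gt_1 by simp
  have cN: "card N + card X = r"
  proof -
    have "es ! 0 \<inter> set (tl vs) = (\<lambda>i. vs ! Suc i) ` X" by (auto simp: tl X_def)
    moreover have "inj_on (\<lambda>i. vs ! Suc i) X"
      using lvs by (auto simp: inj_on_def X_def nth_eq_iff_index_eq)
    ultimately have "card (es ! 0 \<inter> set (tl vs)) = card X" by (simp add: card_image)
    moreover have "card (es ! 0) = card (es ! 0 \<inter> set (tl vs)) + card N"
      using card_Un_disjoint[of "es ! 0 \<inter> set (tl vs)" "es ! 0 - set (tl vs)"] finite_edge[OF e0]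
      by (simp add: N_def free_def Int_Diff_Un Int_Diff_disjoint)
    ultimately show ?thesis using card_edge[OF e0] by simp
  qed
  \<comment> \<open>Index 0 is omitted because its free vertices are \<open>N\<close> itself. This
    leaves r - 1 ends, and \<open>vs ! k\<close> is the r-th.\<close>
  define A where "A = N \<union> g ` (X - {0})"
  have disj: "N \<inter> g ` (X - {0}) = {}"
  proof -
    have "g i \<notin> N" if i: "i \<in> X - {0}" for i
    proof (cases "earlier i")
      case True
      then show ?thesis using nth_not_free[of i] i by (auto simp: g_def N_def X_def)
    next
      case False
      then have "g i \<in> free (es ! i)" using g_free i by blast
      moreover have "free (es ! 0) \<inter> free (es ! i) = {}" using False i X0 by (auto simp: earlier_def)
      ultimately show ?thesis by (auto simp: N_def)
    qed
    then show ?thesis by blast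
  qed
  have finN: "finite N" using finite_edge[OF e0] by (simp add: N_def free_def)
  have "card A = card N + (card X - 1)"
    using card_Un_disjoint[OF finN _ disj] finX X0 g_inj by (simp add: A_def card_image)
  moreover have "card X > 0" using X0 finX by (auto simp: card_gt_0_iff)
  ultimately have cA: "Suc (card A) = r" using cN by simp
  have finA: "finite A" using finN finX by (simp add: A_def)
  have AS: "A \<subseteq> S" using free_S[OF X0] g_S by (auto simp: A_def N_def)
  have A_cases: "(\<exists>i\<in>X. a \<in> free (es ! i)) \<or> (\<exists>i. 0 < i \<and> i < k \<and> a = vs ! i)" if a: "a \<in> A" for a
  proof (cases "a \<in> N")
    case True
    then show ?thesis using X0 by (auto simp: N_def)
  next
    case False
    then obtain i where i: "i \<in> X - {0}" "a = g i" using a unfolding A_def by blast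
    show ?thesis
    proof (cases "earlier i")
      case True
      then have "a = vs ! i" using i by (simp add: g_def)
      then show ?thesis using i by (auto simp: X_def)
    qed (use i g_free in blast)
  qed
  have lA: "vs ! k \<notin> A"
  proof
    assume "vs ! k \<in> A"
    then show False using A_cases[of "vs ! k"] nth_not_free[of k] k_gt_1 lvs
      by (auto simp: nth_eq_iff_index_eq)
  qed
  have cA': "card (insert (vs ! k) A) = r" using lA finA cA by simp
  then show "r \<le> card S" using card_mono[OF finS, of "insert (vs ! k) A"] AS last_S by auto
  \<comment> \<open>The extra end replaces the last vertex of the path by a vertex \<open>w\<close>
    of the last edge outside the path. It exists because that edge avoids \<open>hd vs\<close> by
    \<open>no_return\<close> and is too large for the other \<open>k\<close> vertices. It is new by
    \<open>free_last\<close> and \<open>w \<notin> set vs\<close>.\<close>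
  assume "k < r"
  obtain q v eb e where q: "vs = q @ [v]" "es = eb @ [e]" using ne by (metis append_butlast_last_id)
  have e: "e = es ! (k - 1)" "last es = e" "e \<in> E" using q len lvs(4) by (auto simp: nth_append)
  have "\<not> e \<subseteq> set vs"
  proof
    assume "e \<subseteq> set vs"
    moreover have "hd vs \<notin> e" using no_return[OF P len] e by simp
    ultimately have "e \<subseteq> set (tl vs)" using ne by (metis hd_Cons_tl set_ConsD subsetD subsetI)
    then show False using card_mono[of "set (tl vs)" e] tl(2) card_edge[OF e(3)] \<open>k < r\<close> by simp
  qed
  then obtain w where w: "w \<in> e" "w \<notin> set vs" by blast
  have lq: "length q = Suc (length eb)" using lvs len q by simp
  then have "q \<noteq> []" by auto
  have Q: "berge_path V E q eb" "last q \<in> e" "e \<notin> set eb"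
    using P berge_path_append_iff[OF lq, of "[v]" "[]" V E e] by (auto simp: q)
  have "berge_path V E (w # rev q) (e # rev eb)"
  proof (rule berge_path_Cons[OF berge_path_rev[OF Q(1)]])
    show "w \<in> V" "w \<notin> set (rev q)" "w \<in> e" "e \<in> E"
      using w q(1) e(3) edge_subset[OF e(3)] by auto
    show "e \<notin> set (rev eb)" "hd (rev q) \<in> e" using Q(2,3) \<open>q \<noteq> []\<close> by (simp_all add: hd_rev)
  qed
  then have "w \<in> S" using SI[of "w # rev q" "e # rev eb"] q by auto
  moreover have nth_w: "vs ! i \<noteq> w" if "i \<le> k" for i
    using w(2) nth_mem[of i vs] lvs(1) that by auto
  have "w \<notin> A"
  proof
    assume "w \<in> A"
    then show False
      using A_cases[of w] free_last[of _ w] w(1) e(1) nth_w by (metis less_imp_le)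
  qed
  then have "w \<notin> insert (vs ! k) A" using nth_w[of k] by auto
  then have "card (insert w (insert (vs ! k) A)) = Suc r" using cA' finA by simp
  ultimately show "Suc r \<le> card S"
    using card_mono[OF finS, of "insert w (insert (vs ! k) A)"] AS last_S by auto
qed

section \<open>Combining the cases\<close>

lemma exists_small_incidence:
  assumes r3: "3 \<le> r"
  shows "\<exists>S. S \<subseteq> V \<and> S \<noteq> {} \<and> (\<forall>e \<in> incident_edges E S. path_number V E e = k) \<and>
            ((k = r \<and> card S = r \<and> card (incident_edges E S) \<le> r) \<or>
             (k = r \<and> card S \<ge> r + 1 \<and> card (incident_edges E S) \<le> r + 1) \<or>
             (k < r \<and> card S \<ge> r + 1 \<and> card (incident_edges E S) \<le> k))"
proof -
  consider (long) vs es f where "berge_cycle V E vs es f" "length vs = Suc k"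
    | (short) vs es f where "berge_cycle V E vs es f" "length vs = k" "k < r"
    | (spanning) vs es f where "berge_cycle V E vs es f" "length vs = k" "k = r"
    | (acyclic) "\<forall>vs es f. berge_cycle V E vs es f \<longrightarrow> length vs \<noteq> k \<and> length vs \<noteq> Suc k"
    using k_le_r by (metis le_neq_implies_less)
  then show ?thesis
  proof cases
    case long
    then show ?thesis
      using long_cycle[OF long] by (intro exI[of _ V]) (auto simp: incident_edges_V)
  next
    case spanning
    then show ?thesis
      using cycle_spanning[OF spanning(3) r3 spanning(1,2)]
      by (intro exI[of _ V]) (auto simp: incident_edges_V)
  next
    case short
    define F where "F = insert f (set es)"
    note * = cycle_short[OF short(3,1,2), folded F_def]
    have "card (incident_edges E (\<Union>F)) \<le> k"
      using card_mono[OF _ *(3)] *(4) by (simp add: F_def)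
    moreover have "\<Union>F \<noteq> {}" using *(2) by force
    ultimately show ?thesis using * short(3) by (intro exI[of _ "\<Union>F"]) auto
  next
    case acyclic
    obtain vs es where P: "berge_path V E vs es" "length es = k"
      using longest by (auto simp: longest_path_length_def)
    define S where "S = {v. \<exists>us fs. berge_path V E us fs \<and> set fs = set es \<and> hd us = v}"
    note * = acyclic_ends[OF acyclic P, folded S_def]
    have inc: "(\<forall>e \<in> incident_edges E T. path_number V E e = k) \<and> card (incident_edges E T) \<le> k"
      if "T \<subseteq> S" for T
    proof -
      have sub: "incident_edges E T \<subseteq> set es" using *(4) that by (auto simp: incident_edges_def)
      then show ?thesis
        using path_number_eqI[OF longest P] card_mono[OF _ sub] card_length[of es] P(2) by (auto simp: subset_iff)
    qed
    show ?thesis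
    proof (cases "k = r")
      case True
      \<comment> \<open>A subset meets no further edges, so \<open>S\<close> may be trimmed to the
        exact size r demanded by (i).\<close>
      obtain T where T: "T \<subseteq> S" "card T = r" using obtain_subset_with_card_n[OF *(2)] by blast
      moreover have "T \<noteq> {}" using T r3 by auto
      ultimately show ?thesis using inc[OF T(1)] True *(1) by (intro exI[of _ T]) auto
    next
      case False
      then have "k < r" using k_le_r by simp
      moreover have "S \<noteq> {}" using *(2) r3 by auto
      ultimately show ?thesis using inc[of S] * by (intro exI[of _ S]) auto
    qed
  qed
qed

end

section \<open>From small incidence to a good set\<close>

text \<open>The coefficient \<open>r choose (r - 1)\<close> equals \<open>r\<close> and cancels the
  factor 1 / r.\<close>

lemma f_bound_self: "1 < r \<Longrightarrow> f_bound r (real r) = 1"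
  using binomial_symmetric[of "r - 1" r]
  by (auto simp: f_bound_def simp flip: binomial_gbinomial)

theorem theorem3p7:
  fixes V :: "'a set" and E :: "'a set set" and r n k :: nat
  assumes "r \<ge> 3"
    and "hypergraph V E" and "uniform r E" and "hyp_connected V E" and "card V = n"
    and "longest_path_length V E k" and "1 < k" and "k \<le> r"
  shows "(\<exists>S. S \<subseteq> V \<and> S \<noteq> {} \<and>
            (\<forall>e \<in> incident_edges E S. path_number V E e = k) \<and>
            ((k = r \<and> card S = r \<and> card (incident_edges E S) \<le> r) \<or>
             (k = r \<and> card S \<ge> r + 1 \<and> card (incident_edges E S) \<le> r + 1) \<or>
             (1 < k \<and> k < r \<and> card S \<ge> r + 1 \<and> card (incident_edges E S) \<le> k) \<or>
             (card S = r - 1 \<and> card (incident_edges E S) = 1)))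
         \<and> good_sets r V E \<noteq> {}"
proof -
  interpret longest_berge_path V E r k by unfold_locales (use assms in auto)
  obtain S where S: "S \<subseteq> V" "S \<noteq> {}" "\<forall>e \<in> incident_edges E S. path_number V E e = k"
    and c: "(k = r \<and> card S = r \<and> card (incident_edges E S) \<le> r) \<or>
             (k = r \<and> card S \<ge> r + 1 \<and> card (incident_edges E S) \<le> r + 1) \<or>
             (k < r \<and> card S \<ge> r + 1 \<and> card (incident_edges E S) \<le> k)"
    using exists_small_incidence[OF assms(1)] by blast
  have "real (card (incident_edges E S)) \<le> f_bound r (real k) * real (card S)"
  proof (cases "k = r")
    \<comment> \<open>The bound now reads |N(S)| \<le> |S|, which follows from (i) by |S| = r and
      from (ii) by |S| \<ge> r + 1.\<close>
    case True
    then show ?thesis using c f_bound_self[of r] assms(1) by auto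
  next
    case False
    then have k: "k < r" "r + 1 \<le> card S" "card (incident_edges E S) \<le> k" using c by auto
    then have "f_bound r (real k) = real k / (real r + 1)" using assms(7) by (auto simp: f_bound_def)
    moreover have "real k * (real r + 1) \<le> real k * real (card S)"
      using k(2) by (intro mult_left_mono) auto
    ultimately have "real k \<le> f_bound r (real k) * real (card S)"
      by (simp add: pos_le_divide_eq)
    then show ?thesis using k(3) by linarith
  qed
  then have "S \<in> good_sets r V E" using S assms(6) by (auto simp: good_sets_def)
  then show ?thesis using S c assms(7) by blast
qed

end
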